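(* Let $X$ be a real locally convex Hausdorff topological vector space, $T$ a nonempty index set, $a_t\in X^*$ and $b_t\in\mathbb R$ for $t\in T$, and assume $\{x\in X:\langle a_t,x\rangle\le b_t\ \forall t\in T\}\ne\emptyset$. The following statements are equivalent: (i) For all $(c,s)\in X^*\times\mathbb R$ the next two assertions are equivalent: $\quad(\alpha')$ for every $x\in X$: $\ \big[\langle a_t,x\rangle\le b_t\ \ \forall t\in T\big]\Longrightarrow\langle c,x\rangle\ge s$; $\quad(\beta')$ there exist $\bar t\in T$ and $\bar\lambda\ge0$ such that $\bar\lambda a_{\bar t}=-c$ and $\bar\lambda b_{\bar t}\le-s$. (ii) $\bigcup_{t\in T}\operatorname{co}\operatorname{cone}\{(a_t,b_t),(0_{X^*},1)\}$ is a closed and convex subset of $X^*\times\mathbb R$.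
   Context: $X^*$ is the topological dual of $X$ with the weak* topology; $X^*\times\mathbb R$ has the product topology. $\operatorname{cone}B=\{\lambda b:\lambda\ge0,b\in B\}$, $\operatorname{co}$ is the convex hull. *)

theory Defs
  imports "HOL-Analysis.Analysis"
begin

class topological_real_vector = real_vector + topological_ab_group_add +
  assumes tendsto_scaleR_nhds:
    "((\<lambda>p. fst p *\<^sub>R snd p) \<longlongrightarrow> r *\<^sub>R x) (nhds r \<times>\<^sub>F nhds x)"

class locally_convex_t2_space = topological_real_vector + t2_space +
  \<comment> \<open>The last conjunct is \<open>convex C\<close>, unfolded because a class axiom may only use class operations.\<close>
  assumes open_convex_base: "open U \<Longrightarrow> x \<in> U \<Longrightarrow> \<exists>C. open C \<and> x \<in> C \<and> C \<subseteq> U \<and>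
    (\<forall>y\<in>C. \<forall>z\<in>C. \<forall>u\<ge>0. \<forall>v\<ge>0. u + v = 1 \<longrightarrow> u *\<^sub>R y + v *\<^sub>R z \<in> C)"

lemma locally_convex_UNIV: "locally convex (UNIV :: 'a::locally_convex_t2_space set)"
proof (rule locallyI)
  fix W :: "'a set" and x
  assume "openin (top_of_set UNIV) W" "x \<in> W"
  then obtain C where "open C" "x \<in> C" "C \<subseteq> W" "convex C"
    using open_convex_base[of W x] unfolding convex_def by auto
  then show "\<exists>U V. openin (top_of_set UNIV) U \<and> convex V \<and> x \<in> U \<and> U \<subseteq> V \<and> V \<subseteq> W"
    by auto
qed

text \<open>The topological dual is a type of its own (and not a type of functions), so that it can carry
  the weak* topology as its type-class topology; the product with \<^typ>\<open>real\<close> then carries the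
  library's product topology and vector space structure.\<close>

typedef (overloaded) 'a dual =
  "{f :: 'a::{real_vector, topological_space} \<Rightarrow> real. linear f \<and> continuous_on UNIV f}"
  morphisms dual_apply Dual
  by (rule exI[of _ "\<lambda>_. 0"]) (auto intro: linear_zero)

notation dual_apply ("\<langle>_,/ _\<rangle>")

setup_lifting type_definition_dual

lemma linear_dual_apply: "linear (dual_apply f)"
  and continuous_on_dual_apply: "continuous_on UNIV (dual_apply f)"
  using dual_apply[of f] by auto

instantiation dual :: ("{real_vector, topological_space}") real_vector
begin

lift_definition zero_dual :: "'a dual" is "\<lambda>_. 0"
  by (auto intro: linear_zero)

lift_definition plus_dual :: "'a dual \<Rightarrow> 'a dual \<Rightarrow> 'a dual" is "\<lambda>f g x. f x + g x"
  by (auto intro: linear_compose_add continuous_intros)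

lift_definition uminus_dual :: "'a dual \<Rightarrow> 'a dual" is "\<lambda>f x. - f x"
  by (auto intro: linear_compose_neg continuous_intros)

lift_definition minus_dual :: "'a dual \<Rightarrow> 'a dual \<Rightarrow> 'a dual" is "\<lambda>f g x. f x - g x"
  by (auto intro: linear_compose_sub continuous_intros)

lift_definition scaleR_dual :: "real \<Rightarrow> 'a dual \<Rightarrow> 'a dual" is "\<lambda>r f x. r * f x"
  by (auto intro: continuous_intros simp: linear_iff algebra_simps)

instance
  by standard (transfer; auto simp: algebra_simps fun_eq_iff)+

end

text \<open>The weak* topology: the coarsest topology for which all evaluations
  \<open>\<lambda>f. \<langle>f, x\<rangle>\<close> are continuous.\<close>

instantiation dual :: ("{real_vector, topological_space}") topological_space
begin

definition open_dual :: "'a dual set \<Rightarrow> bool" where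
  "open_dual = generate_topology {(\<lambda>f. \<langle>f, x\<rangle>) -` U | x U. open (U :: real set)}"

instance
  by standard
    (auto simp: open_dual_def intro: generate_topology.UNIV generate_topology.Int generate_topology.UN)

end

definition cone_of :: "'a::real_vector set \<Rightarrow> 'a set" where
  "cone_of B = {l *\<^sub>R b | l b. 0 \<le> l \<and> b \<in> B}"

lemma cone_of_eq_cone_hull: "cone_of B = cone hull B"
  unfolding cone_of_def cone_hull_expl by blast

end

theory Submission
  imports Defs
begin

text \<open>Let \<open>K\<close> be the union of the cones and let \<open>M\<close> be the set of all \<open>(f, r)\<close> such that \<open>f \<le> r\<close> holds on
  the feasible set. Statement (i) says \<open>K = M\<close>, because (\<open>\<beta>'\<close>) means \<open>(-c, -s) \<in> K\<close> and (\<open>\<alpha>'\<close>)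
  means \<open>(-c, -s) \<in> M\<close>. The set \<open>M\<close> is always closed, convex and contains \<open>K\<close>. If \<open>K\<close> is closed and
  convex, a point outside \<open>K\<close> is separated from the cone \<open>K\<close> by some \<open>(y, \<rho>)\<close> in \<open>X \<times> \<real>\<close>; adding
  a small multiple of \<open>(x, -1)\<close> with \<open>x\<close> feasible makes \<open>\<rho>\<close> negative, and then
  \<open>y / (- \<rho>)\<close> is a feasible point showing that the point is outside \<open>M\<close>.

  Weak* neighbourhoods constrain only finitely many evaluations, so the separation
  takes place in a finite-dimensional space.\<close>

text \<open>The vector \<open>z\<close> is the point of minimal norm in the closure of \<open>S\<close>; a minimizing sequence is Cauchy
  by the parallelogram law. Points are functions restricted to a finite index set because no type
  has a dimension that depends on \<open>J\<close>.\<close>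

lemma convex_away_from_zero_separation:
  fixes S :: "('j \<Rightarrow> real) set"
  assumes J: "finite J" and S: "S \<noteq> {}" and e: "0 < e"
    and conv: "\<And>u v t. \<lbrakk>u \<in> S; v \<in> S; 0 \<le> t; t \<le> 1\<rbrakk> \<Longrightarrow> (\<lambda>j. (1 - t) * u j + t * v j) \<in> S"
    and away: "\<And>u. u \<in> S \<Longrightarrow> e \<le> (\<Sum>j\<in>J. (u j)\<^sup>2)"
  obtains d z where "0 < d" "\<And>u. u \<in> S \<Longrightarrow> d \<le> (\<Sum>j\<in>J. z j * u j)"
proof -
  define N where "N u = (\<Sum>j\<in>J. (u j)\<^sup>2)" for u :: "'j \<Rightarrow> real"
  define d where "d = (INF u\<in>S. N u)"
  have bdd: "bdd_below (N ` S)"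
    using away by (intro bdd_belowI2[of _ e]) (simp add: N_def)
  have d_le: "d \<le> N u" if "u \<in> S" for u
    unfolding d_def using bdd that by (rule cINF_lower)
  have "e \<le> d"
    unfolding d_def using S away by (intro cINF_greatest) (auto simp: N_def)
  then have d: "0 < d" using e by simp
  have "\<exists>u\<in>S. N u < d + 1 / real (Suc n)" for n
    using cINF_less_iff[OF S bdd, of "d + 1 / real (Suc n)"] by (simp add: d_def)
  then obtain w where wS: "\<And>n. w n \<in> S" and wN: "\<And>n. N (w n) < d + 1 / real (Suc n)"
    by metis
  \<comment> \<open>The midpoint is written in the form of \<open>conv\<close> with
    \<open>t = 1/2\<close>, so for \<open>u\<close> and \<open>v\<close> in \<open>S\<close> its
    \<open>N\<close> is at least \<open>d\<close>.\<close>
  have parallelogram: "N (\<lambda>j. u j - v j) =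
      2 * N u + 2 * N v - 4 * N (\<lambda>j. (1 - 1/2) * u j + 1/2 * v j)" for u v
    unfolding N_def sum_distrib_left sum.distrib[symmetric] sum_subtractf[symmetric]
    by (rule sum.cong) (auto simp: power2_eq_square algebra_simps)
  have dist_w: "(w n j - w m j)\<^sup>2 < 2 / real (Suc n) + 2 / real (Suc m)" if "j \<in> J" for n m j
  proof -
    have "(w n j - w m j)\<^sup>2 \<le> N (\<lambda>j. w n j - w m j)"
      unfolding N_def using member_le_sum[OF that, of "\<lambda>j. (w n j - w m j)\<^sup>2"] J by simp
    moreover have "d \<le> N (\<lambda>j. (1 - 1/2) * w n j + 1/2 * w m j)"
      by (intro d_le conv wS) auto
    ultimately show ?thesis
      using wN[of n] wN[of m] unfolding parallelogram by linarith
  qed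
  have "Cauchy (\<lambda>n. w n j)" if "j \<in> J" for j
  proof (rule metric_CauchyI)
    fix r :: real assume r: "0 < r"
    \<comment> \<open>From this index on, each of the two error terms in \<open>dist_w\<close> is at
      most \<open>r\<^sup>2 / 2\<close>.\<close>
    then obtain k where k: "4 / r\<^sup>2 < real k" using reals_Archimedean2 by blast
    have small: "2 / real (Suc n) \<le> r\<^sup>2 / 2" if "k \<le> n" for n
    proof -
      have "4 / r\<^sup>2 \<le> real (Suc n)" using k that by linarith
      then show ?thesis using r by (simp add: field_simps)
    qed
    have "dist (w m j) (w n j) < r" if "k \<le> m" "k \<le> n" for m n
    proof -
      have "(w m j - w n j)\<^sup>2 < r\<^sup>2"
        using dist_w[OF \<open>j \<in> J\<close>, of m n] small[OF that(1)] small[OF that(2)] by linarith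
      then show ?thesis
        using r by (metis abs_le_square_iff abs_of_pos dist_real_def linorder_not_less)
    qed
    then show "\<exists>k. \<forall>m\<ge>k. \<forall>n\<ge>k. dist (w m j) (w n j) < r" by blast
  qed
  then have "\<forall>j\<in>J. \<exists>l. (\<lambda>n. w n j) \<longlonglongrightarrow> l"
    using Cauchy_convergent convergent_def by blast
  \<comment> \<open>Only the values of \<open>z\<close> on \<open>J\<close> are determined, and
    \<open>N\<close> reads no others.\<close>
  then obtain z where z: "\<And>j. j \<in> J \<Longrightarrow> (\<lambda>n. w n j) \<longlonglongrightarrow> z j" by metis
  have "(\<lambda>n. N (w n)) \<longlonglongrightarrow> N z"
    unfolding N_def by (intro tendsto_intros z)
  moreover have "(\<lambda>n. N (w n)) \<longlonglongrightarrow> d"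
  proof (rule tendsto_sandwich[OF _ _ tendsto_const])
    show "(\<lambda>n. d + 1 / real (Suc n)) \<longlonglongrightarrow> d"
      using LIMSEQ_inverse_real_of_nat_add[of d] by (simp add: inverse_eq_divide)
  qed (use d_le wS wN in \<open>auto intro!: always_eventually less_imp_le\<close>)
  ultimately have Nz: "N z = d" by (rule LIMSEQ_unique)
  have "d \<le> (\<Sum>j\<in>J. z j * u j)" if u: "u \<in> S" for u
  proof (rule ccontr)
    assume neg: "\<not> ?thesis"
    define g where "g = d - (\<Sum>j\<in>J. z j * u j)"
    define q where "q = N (\<lambda>j. u j - z j)"
    have g: "0 < g" using neg by (simp add: g_def)
    have q: "0 \<le> q" unfolding q_def N_def by (rule sum_nonneg) simp
    \<comment> \<open>The limit \<open>z\<close> need not lie in \<open>S\<close>, so the bound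
      \<open>d\<close> is applied along \<open>w\<close> and passed to the limit. The expansion
      around \<open>z\<close> in direction \<open>u - z\<close> has linear term
      \<open>- 2 * g * t\<close>.\<close>
    have quadratic: "2 * g * t \<le> t\<^sup>2 * q" if t: "0 \<le> t" "t \<le> 1" for t
    proof -
      have "(\<lambda>n. N (\<lambda>j. (1 - t) * w n j + t * u j)) \<longlonglongrightarrow> N (\<lambda>j. (1 - t) * z j + t * u j)"
        unfolding N_def by (intro tendsto_intros z)
      then have "d \<le> N (\<lambda>j. (1 - t) * z j + t * u j)"
        by (rule LIMSEQ_le_const) (use d_le conv wS u t in blast)
      also have "\<dots> = N z - 2 * t * N z + 2 * t * (\<Sum>j\<in>J. z j * u j) + t\<^sup>2 * q"
        unfolding N_def q_def sum_distrib_left sum.distrib[symmetric] sum_subtractf[symmetric]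
        by (rule sum.cong) (auto simp: power2_eq_square algebra_simps)
      finally show ?thesis unfolding Nz g_def by (simp add: algebra_simps)
    qed
    \<comment> \<open>For this step size \<open>t * q\<close> is at most \<open>g\<close>, too small
      for the bound \<open>2 * g \<le> t * q\<close> that \<open>quadratic\<close> demands.\<close>
    define t where "t = g / (g + q)"
    have t: "0 < t" "t \<le> 1" using g q by (auto simp: t_def)
    have "2 * g \<le> t * q"
      using quadratic[of t] t by (simp add: power2_eq_square)
    also have "t * q \<le> g"
      using g q by (simp add: t_def field_simps)
    finally show False using g by simp
  qed
  with d show ?thesis by (rule that)
qed

lemma continuous_on_dual_eval: "continuous_on A (\<lambda>f. \<langle>f, x\<rangle>)"
proof -
  have "open ((\<lambda>f. \<langle>f, x\<rangle>) -` U)" if "open U" for U :: "real set"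
    unfolding open_dual_def using that by (intro generate_topology.Basis) blast
  then have "continuous_on UNIV (\<lambda>f. \<langle>f, x\<rangle>)"
    by (simp add: continuous_on_open_vimage)
  then show ?thesis by (rule continuous_on_subset) simp
qed

text \<open>Induction on the generation of the topology: a subbasic set needs one evaluation, an
  intersection takes the union of the finite sets and the smaller radius, and a union inherits the
  data of one member.\<close>

lemma open_dual_finite_neighbourhood:
  fixes f :: "'a::{real_vector, topological_space} dual"
  assumes "open U" "f \<in> U"
  obtains F e where "finite F" "0 < e"
    "\<And>g. (\<And>x. x \<in> F \<Longrightarrow> \<bar>\<langle>g, x\<rangle> - \<langle>f, x\<rangle>\<bar> < e) \<Longrightarrow> g \<in> U"
proof -
  have "\<exists>F e. finite F \<and> 0 < e \<and> (\<forall>g. (\<forall>x\<in>F. \<bar>\<langle>g, x\<rangle> - \<langle>f, x\<rangle>\<bar> < e) \<longrightarrow> g \<in> U)"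
    using assms(1)[unfolded open_dual_def] assms(2)
  proof (induction rule: generate_topology.induct)
    case UNIV
    show ?case by (intro exI[of _ "{}"] exI[of _ 1]) auto
  next
    case (Int A B)
    then obtain F e G e' where
      "finite F" "0 < e" "\<And>g. \<forall>x\<in>F. \<bar>\<langle>g, x\<rangle> - \<langle>f, x\<rangle>\<bar> < e \<Longrightarrow> g \<in> A"
      "finite G" "0 < e'" "\<And>g. \<forall>x\<in>G. \<bar>\<langle>g, x\<rangle> - \<langle>f, x\<rangle>\<bar> < e' \<Longrightarrow> g \<in> B"
      by blast
    then show ?case
      by (intro exI[of _ "F \<union> G"] exI[of _ "min e e'"]) auto
  next
    case (UN K)
    then show ?case by (metis UnionE UnionI)
  next
    case (Basis V)
    then obtain x W where V: "V = (\<lambda>g. \<langle>g, x\<rangle>) -` W" and W: "open W" by blast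
    then obtain e where "0 < e" "\<And>r. dist r \<langle>f, x\<rangle> < e \<Longrightarrow> r \<in> W"
      using Basis(2) by (metis open_dist vimageE)
    then show ?case
      unfolding V by (intro exI[of _ "{x}"] exI[of _ e]) (auto simp: dist_real_def)
  qed
  then show ?thesis using that by metis
qed

text \<open>A linear functional of finitely many evaluations is itself an evaluation at a linear
  combination of the points, so the separating functional comes from some \<open>y\<close> in the
  space and not only from its bidual.\<close>

lemma closed_convex_cone_weak_star_separation:
  fixes K :: "('a::{real_vector, topological_space} dual \<times> real) set"
  assumes "closed K" "convex K" "cone K" "0 \<in> K" "p \<notin> K"
  obtains y \<rho> where "\<And>k. k \<in> K \<Longrightarrow> \<langle>fst k, y\<rangle> + \<rho> * snd k \<le> 0"
    "0 < \<langle>fst p, y\<rangle> + \<rho> * snd p"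
proof -
  have "open (- K)" "p \<in> - K" using assms by auto
  then obtain U V where U: "open U" "fst p \<in> U" and V: "open V" "snd p \<in> V" and UV: "U \<times> V \<subseteq> - K"
    unfolding open_prod_def by (metis mem_Times_iff)
  obtain F e where F: "finite F" and e: "0 < e"
    and FU: "\<And>g. (\<And>x. x \<in> F \<Longrightarrow> \<bar>\<langle>g, x\<rangle> - \<langle>fst p, x\<rangle>\<bar> < e) \<Longrightarrow> g \<in> U"
    using open_dual_finite_neighbourhood[OF U] by blast
  obtain e' where e': "0 < e'" and eV: "\<And>r. \<bar>r - snd p\<bar> < e' \<Longrightarrow> r \<in> V"
    using V by (metis open_dist dist_real_def)
  define h where "h = min e e'"
  have h: "0 < h" using e e' by (simp add: h_def)
  \<comment> \<open>The index \<open>(x, 0)\<close> stands for evaluation at \<open>x\<close>, and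
    \<open>(0, 1)\<close> for the real component; \<open>\<phi>\<close> pairs a point with an index.
    \<open>S\<close> below is \<open>K - p\<close> seen through these coordinates.\<close>
  define J where "J = insert (0, 1) ((\<lambda>x. (x, 0 :: real)) ` F)"
  define \<phi> where "\<phi> k j = \<langle>fst k, fst j\<rangle> + snd j * snd k"
    for k :: "'a dual \<times> real" and j :: "'a \<times> real"
  have \<phi>_add: "\<phi> (k + l) j = \<phi> k j + \<phi> l j" and \<phi>_scale: "\<phi> (r *\<^sub>R k) j = r * \<phi> k j" for k l j r
    by (simp_all add: \<phi>_def plus_dual.rep_eq scaleR_dual.rep_eq algebra_simps)
  have J: "finite J" using F by (simp add: J_def)
  define S where "S = {u. \<exists>k\<in>K. \<forall>j. u j = \<phi> k j - \<phi> p j}"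
  have SI: "(\<lambda>j. \<phi> k j - \<phi> p j) \<in> S" if "k \<in> K" for k using that by (auto simp: S_def)
  have S: "S \<noteq> {}" using SI assms(4) by blast
  have h2: "0 < h\<^sup>2" using h by simp
  have conv: "(\<lambda>j. (1 - t) * u j + t * v j) \<in> S"
    if "u \<in> S" "v \<in> S" "0 \<le> t" "t \<le> 1" for u v t
  proof -
    obtain k l where kl: "k \<in> K" "\<forall>j. u j = \<phi> k j - \<phi> p j" "l \<in> K" "\<forall>j. v j = \<phi> l j - \<phi> p j"
      using \<open>u \<in> S\<close> \<open>v \<in> S\<close> by (auto simp: S_def)
    have "(1 - t) *\<^sub>R k + t *\<^sub>R l \<in> K"
      using kl that assms(2) by (simp add: convex_alt)
    moreover have "(1 - t) * u j + t * v j = \<phi> ((1 - t) *\<^sub>R k + t *\<^sub>R l) j - \<phi> p j" for j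
      unfolding \<phi>_add \<phi>_scale kl(2)[rule_format] kl(4)[rule_format] by (simp add: algebra_simps)
    ultimately show ?thesis unfolding S_def by blast
  qed
  \<comment> \<open>Otherwise all coordinates in \<open>J\<close> are smaller than \<open>h\<close>,
    which puts a point of \<open>K\<close> into \<open>U \<times> V\<close>.\<close>
  have away: "h\<^sup>2 \<le> (\<Sum>j\<in>J. (u j)\<^sup>2)" if u: "u \<in> S" for u
  proof (rule ccontr)
    assume small: "\<not> ?thesis"
    obtain k where k: "k \<in> K" "\<And>j. u j = \<phi> k j - \<phi> p j" using u by (auto simp: S_def)
    have uh: "\<bar>u j\<bar> < h" if "j \<in> J" for j
    proof -
      have "(u j)\<^sup>2 \<le> (\<Sum>j\<in>J. (u j)\<^sup>2)"
        using J that by (intro member_le_sum) auto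
      then have "(u j)\<^sup>2 < h\<^sup>2" using small by simp
      then show ?thesis using h by (metis abs_le_square_iff abs_of_pos linorder_not_less)
    qed
    have "\<bar>\<langle>fst k, x\<rangle> - \<langle>fst p, x\<rangle>\<bar> < e" if "x \<in> F" for x
      using uh[of "(x, 0)"] that by (auto simp: J_def k \<phi>_def h_def)
    then have "fst k \<in> U" by (rule FU)
    moreover have "snd k \<in> V"
      using uh[of "(0, 1)"]
      by (intro eV) (auto simp: J_def k \<phi>_def h_def linear_0[OF linear_dual_apply])
    ultimately show False using UV k by (auto simp: mem_Times_iff)
  qed
  obtain d z where d: "0 < d" and z: "\<And>u. u \<in> S \<Longrightarrow> d \<le> (\<Sum>j\<in>J. z j * u j)"
    using convex_away_from_zero_separation[OF J S h2 conv away] by blast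
  \<comment> \<open>The minus signs turn the lower bound \<open>d\<close> on \<open>K - p\<close>
    into \<open>L k \<le> L p - d\<close>.\<close>
  define y where "y = - (\<Sum>j\<in>J. z j *\<^sub>R fst j)"
  define \<rho> where "\<rho> = - (\<Sum>j\<in>J. z j * snd j)"
  define L where "L k = \<langle>fst k, y\<rangle> + \<rho> * snd k" for k :: "'a dual \<times> real"
  have L_eq: "L k = - (\<Sum>j\<in>J. z j * \<phi> k j)" for k
    by (simp add: L_def y_def \<rho>_def \<phi>_def linear_neg[OF linear_dual_apply]
        linear_sum[OF linear_dual_apply] linear_scale[OF linear_dual_apply]
        sum.distrib sum_distrib_left algebra_simps)
  have L_scale: "L (r *\<^sub>R k) = r * L k" for r k
    by (simp add: L_def scaleR_dual.rep_eq algebra_simps)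
  have sep: "L k \<le> L p - d" if "k \<in> K" for k
    using z[OF SI[OF that]] by (simp add: L_eq sum_subtractf right_diff_distrib)
  have "0 < L p"
    using sep[OF assms(4)] d L_scale[of 0 0] by simp
  moreover have "L k \<le> 0" if "k \<in> K" for k
  proof (rule ccontr)
    assume pos: "\<not> ?thesis"
    \<comment> \<open>The multiple is chosen so that \<open>L\<close> takes the value
      \<open>L p\<close> on it, which \<open>sep\<close> forbids.\<close>
    then have "(L p / L k) *\<^sub>R k \<in> K"
      using \<open>0 < L p\<close> assms(3) that by (simp add: cone_def)
    from sep[OF this] show False using pos d by (simp add: L_scale)
  qed
  ultimately show ?thesis using that by (auto simp: L_def)
qed

text \<open>Makes membership in the union explicit, with the coefficient of \<open>(0, 1)\<close> as
  slack in the real component.\<close>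

lemma convex_hull_cone_of_pair:
  "convex hull (cone_of {u, v}) = {l *\<^sub>R u + m *\<^sub>R v | l m. 0 \<le> l \<and> 0 \<le> m}" (is "_ = ?C")
proof
  have C: "l *\<^sub>R u + m *\<^sub>R v \<in> ?C" if "0 \<le> l" "0 \<le> m" for l m
    using that by blast
  show "convex hull (cone_of {u, v}) \<subseteq> ?C"
  proof (rule hull_minimal)
    show "cone_of {u, v} \<subseteq> ?C"
    proof
      fix w assume "w \<in> cone_of {u, v}"
      then obtain l where "0 \<le> l" "w = l *\<^sub>R u \<or> w = l *\<^sub>R v" by (auto simp: cone_of_def)
      then show "w \<in> ?C" using C[of l 0] C[of 0 l] by auto
    qed
    show "convex ?C"
    proof (rule convexI)
      fix x y and r s :: real
      assume "x \<in> ?C" "y \<in> ?C" and rs: "0 \<le> r" "0 \<le> s"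
      then obtain l m l' m' where *: "x = l *\<^sub>R u + m *\<^sub>R v" "y = l' *\<^sub>R u + m' *\<^sub>R v"
        "0 \<le> l" "0 \<le> m" "0 \<le> l'" "0 \<le> m'" by blast
      have "(r * l + s * l') *\<^sub>R u + (r * m + s * m') *\<^sub>R v \<in> ?C"
        using * rs by (intro C) auto
      then show "r *\<^sub>R x + s *\<^sub>R y \<in> ?C" by (simp add: * algebra_simps)
    qed
  qed
  show "?C \<subseteq> convex hull (cone_of {u, v})"
  proof
    fix w assume "w \<in> ?C"
    then obtain l m where w: "w = l *\<^sub>R u + m *\<^sub>R v" "0 \<le> l" "0 \<le> m" by blast
    \<comment> \<open>The doubled multiples compensate for the weights \<open>1/2\<close> of the
      midpoint.\<close>
    have "(2 * l) *\<^sub>R u \<in> cone_of {u, v}" "(2 * m) *\<^sub>R v \<in> cone_of {u, v}"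
      using w unfolding cone_of_def by (force simp del: scaleR_scaleR)+
    then have "(1/2) *\<^sub>R ((2 * l) *\<^sub>R u) + (1/2) *\<^sub>R ((2 * m) *\<^sub>R v) \<in> convex hull (cone_of {u, v})"
      by (intro convexD[OF convex_convex_hull] hull_inc) auto
    then show "w \<in> convex hull (cone_of {u, v})" by (simp add: w)
  qed
qed

lemma closed_upper_bounds: "closed {p. \<forall>x\<in>F. \<langle>fst p, x\<rangle> \<le> snd p}"
proof -
  have "closed {p :: 'a dual \<times> real. \<langle>fst p, x\<rangle> \<le> snd p}" for x :: 'a
    by (intro closed_Collect_le continuous_intros
        continuous_on_compose2[OF continuous_on_dual_eval[of UNIV]]) auto
  then have "closed (\<Inter>x\<in>F. {p :: 'a dual \<times> real. \<langle>fst p, x\<rangle> \<le> snd p})"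
    by (intro closed_INT) auto
  then show ?thesis
    by (rule back_subst[of closed]) blast
qed

lemma convex_upper_bounds: "convex {p. \<forall>x\<in>F. \<langle>fst p, x\<rangle> \<le> snd p}"
  by (auto simp: convex_def plus_dual.rep_eq scaleR_dual.rep_eq intro!: add_mono mult_left_mono)

theorem corollary6p6:
  fixes T :: "'i set"
    and a :: "'i \<Rightarrow> 'a::locally_convex_t2_space dual"
    and b :: "'i \<Rightarrow> real"
  assumes "T \<noteq> {}"
    and "{x. \<forall>t\<in>T. \<langle>a t, x\<rangle> \<le> b t} \<noteq> {}"
  shows
    "(\<forall>(c :: 'a dual) (s :: real).
        (\<forall>x. (\<forall>t\<in>T. \<langle>a t, x\<rangle> \<le> b t) \<longrightarrow> \<langle>c, x\<rangle> \<ge> s)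
        \<longleftrightarrow> (\<exists>t\<in>T. \<exists>l\<ge>0. l *\<^sub>R a t = - c \<and> l * b t \<le> - s))
     \<longleftrightarrow>
     (closed (\<Union>t\<in>T. convex hull (cone_of {(a t, b t), (0, 1)}))
        \<and> convex (\<Union>t\<in>T. convex hull (cone_of {(a t, b t), (0, 1)})))"
proof -
  define K where "K = (\<Union>t\<in>T. convex hull (cone_of {(a t, b t), (0, 1)}))"
  define F where "F = {x. \<forall>t\<in>T. \<langle>a t, x\<rangle> \<le> b t}"
  define M where "M = {p. \<forall>x\<in>F. \<langle>fst p, x\<rangle> \<le> snd p}"
  have K_iff: "(f, r) \<in> K \<longleftrightarrow> (\<exists>t\<in>T. \<exists>l\<ge>0. l *\<^sub>R a t = f \<and> l * b t \<le> r)" for f r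
  proof -
    have "(\<exists>l m. f = l *\<^sub>R a t \<and> r = l * b t + m \<and> 0 \<le> l \<and> 0 \<le> m)
        \<longleftrightarrow> (\<exists>l\<ge>0. l *\<^sub>R a t = f \<and> l * b t \<le> r)" for t
      by (metis add.commute diff_add_cancel diff_ge_0_iff_ge le_add_same_cancel1)
    then show ?thesis by (simp add: K_def convex_hull_cone_of_pair)
  qed
  have "K \<subseteq> M"
  proof clarify
    fix f r assume "(f, r) \<in> K"
    then obtain t l where tl: "t \<in> T" "0 \<le> l" "l *\<^sub>R a t = f" "l * b t \<le> r"
      using K_iff by blast
    have "l * \<langle>a t, x\<rangle> \<le> r" if "x \<in> F" for x
      using mult_left_mono[of "\<langle>a t, x\<rangle>" "b t" l] tl that by (force simp: F_def)
    then show "(f, r) \<in> M" by (auto simp: M_def scaleR_dual.rep_eq simp flip: tl(3))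
  qed
  have "(\<forall>c s. (\<forall>x. (\<forall>t\<in>T. \<langle>a t, x\<rangle> \<le> b t) \<longrightarrow> \<langle>c, x\<rangle> \<ge> s)
        \<longleftrightarrow> (\<exists>t\<in>T. \<exists>l\<ge>0. l *\<^sub>R a t = - c \<and> l * b t \<le> - s))
      \<longleftrightarrow> (\<forall>c s. (- c, - s) \<in> M \<longleftrightarrow> (- c, - s) \<in> K)"
    by (simp add: K_iff M_def F_def uminus_dual.rep_eq)
  also have "\<dots> \<longleftrightarrow> M = K"
    \<comment> \<open>Negation is a bijection, so the pairs \<open>(- c, - s)\<close> exhaust the
      product space.\<close>
    by (metis minus_minus set_eqI surj_pair)
  also have "\<dots> \<longleftrightarrow> closed K \<and> convex K"
  proof
    assume "M = K"
    then show "closed K \<and> convex K"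
      using closed_upper_bounds[of F] convex_upper_bounds[of F] by (simp add: M_def)
  next
    assume K: "closed K \<and> convex K"
    have "cone K"
      unfolding cone_def
    proof clarify
      fix f and r m :: real assume "(f, r) \<in> K" and m: "0 \<le> m"
      then obtain t l where tl: "t \<in> T" "0 \<le> l" "l *\<^sub>R a t = f" "l * b t \<le> r"
        using K_iff by blast
      have "(m * l) *\<^sub>R a t = m *\<^sub>R f" "(m * l) * b t \<le> m * r" "0 \<le> m * l"
        using tl m mult_left_mono[OF tl(4) m] by (auto simp: mult.assoc)
      then show "m *\<^sub>R (f, r) \<in> K" using tl(1) by (auto simp: K_iff)
    qed
    have K0: "(0, r) \<in> K" if "0 \<le> r" for r
      using assms(1) that by (force simp: K_iff)
    have Ka: "(a t, b t) \<in> K" if "t \<in> T" for t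
      using that by (auto simp: K_iff intro!: bexI[of _ t] exI[of _ 1])
    have "M \<subseteq> K"
    proof (rule subsetI, rule ccontr)
      fix p assume p: "p \<in> M" "p \<notin> K"
      obtain y \<rho> where K_le: "\<And>k. k \<in> K \<Longrightarrow> \<langle>fst k, y\<rangle> + \<rho> * snd k \<le> 0"
        and p_pos: "0 < \<langle>fst p, y\<rangle> + \<rho> * snd p"
        using closed_convex_cone_weak_star_separation[of K p] K \<open>cone K\<close> K0[of 0] p(2)
        by (auto simp: zero_prod_def)
      obtain x where x: "x \<in> F" using assms(2) by (auto simp: F_def)
      define g where "g = \<langle>fst p, y\<rangle> + \<rho> * snd p"
      define q where "q = snd p - \<langle>fst p, x\<rangle>"
      \<comment> \<open>Small enough that \<open>\<epsilon> * q < g\<close>; the \<open>+ 1\<close>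
        covers the case \<open>q = 0\<close>.\<close>
      define \<epsilon> where "\<epsilon> = g / (q + 1)"
      have gq: "0 < g" "0 \<le> q"
        using p_pos p(1) x by (auto simp: g_def q_def M_def)
      then have \<epsilon>: "0 < \<epsilon>" "\<epsilon> * q < g"
        by (auto simp: \<epsilon>_def field_simps)
      \<comment> \<open>The generator \<open>(0, 1)\<close> fixes the sign of \<open>\<rho>\<close>.
        Since \<open>\<rho>\<close> may vanish, \<open>\<epsilon>\<close> is subtracted from it
        before dividing.\<close>
      have "\<rho> \<le> 0"
        using K_le[OF K0[of 1]] by (simp add: zero_dual.rep_eq)
      then have \<sigma>: "0 < \<epsilon> - \<rho>" using \<epsilon> by simp
      define v where "v = (1 / (\<epsilon> - \<rho>)) *\<^sub>R (y + \<epsilon> *\<^sub>R x)"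
      have v: "\<langle>f, v\<rangle> = (\<langle>f, y\<rangle> + \<epsilon> * \<langle>f, x\<rangle>) / (\<epsilon> - \<rho>)" for f
        by (simp add: v_def linear_add[OF linear_dual_apply] linear_scale[OF linear_dual_apply])
      \<comment> \<open>Add the separation inequality at \<open>(a t, b t)\<close> to
        \<open>\<epsilon>\<close> times the constraint at \<open>x\<close>.\<close>
      have "\<langle>a t, v\<rangle> \<le> b t" if "t \<in> T" for t
      proof -
        have "\<langle>a t, x\<rangle> \<le> b t" using x that by (simp add: F_def)
        then have "\<epsilon> * \<langle>a t, x\<rangle> \<le> \<epsilon> * b t" using \<epsilon> by simp
        then show ?thesis
          using K_le[OF Ka[OF that]] \<sigma> by (simp add: v divide_le_eq algebra_simps)
      qed
      then have "\<langle>fst p, v\<rangle> \<le> snd p" using p(1) by (auto simp: M_def F_def)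
      \<comment> \<open>Clearing the denominator gives \<open>g \<le> \<epsilon> * q\<close>,
        against the choice of \<open>\<epsilon>\<close>.\<close>
      then show False
        using \<sigma> \<epsilon>(2) by (simp add: v divide_le_eq g_def q_def algebra_simps)
    qed
    with \<open>K \<subseteq> M\<close> show "M = K" by blast
  qed
  finally show ?thesis unfolding K_def .
qed

end
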